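(* Let $d\ge2$ be an integer and let $\bar p=(p_j)_{j\ge1}$ be a sequence in $(0,1]$ with $p_j<1$ for infinitely many $j$. The spectrum of the transition operator $S_{\bar p}$ of the $\mathrm{AMFC}_d$ Markov chain associated to $\bar p$, acting on $l^\infty(\mathbb{Z}_+)$, is equal to $$E_{\bar p}=\Big\{z\in\mathbb{C}:\ \limsup_{j\to+\infty}|\tilde f_j(z)|<+\infty\Big\}.$$
   Context: $\mathbb{Z}_+=\{0,1,2,\dots\}$ and $l^\infty(\mathbb{Z}_+)$ is the Banach space of bounded complex sequences. For $n\in\mathbb{Z}_+$ write its $d$-adic expansion $n=\sum_{j\ge1}a_j(n)d^{j-1}$ with $a_j(n)\in\{0,\dots,d-1\}$, and let $\zeta_n=\min\{j\ge1: a_j(n)\ne d-1\}$. The transition probabilities of the $\mathrm{AMFC}_d$ Markov chain are: $s(n,n+1)=\prod_{j=1}^{\zeta_n}p_j$; $s(n,n)=1-p_1$; if $\zeta_n\ge2$, $s\big(n,\,n-\sum_{j=1}^r(d-1)d^{j-1}\big)=(1-p_{r+1})\prod_{j=1}^r p_j$ for $1\le r\le\zeta_n-1$; and $s(n,m)=0$ otherwise. The operator $S_{\bar p}$ is $(S_{\bar p}v)_n=\sum_{m\ge0}s(n,m)v_m$. The polynomials are $f_j(z)=\left(\frac{z-(1-p_j)}{p_j}\right)^d$ for $j\ge1$, and $\tilde f_j=f_j\circ\cdots\circ f_1$. *)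

theory Defs
  imports "HOL-Analysis.Analysis"
begin

text \<open>The topology of \<^typ>\<open>nat\<close> is discrete, so the bounded continuous functions on
  \<^typ>\<open>nat\<close> are exactly the bounded sequences, and the library norm is the sup norm.\<close>

type_synonym linf = "nat \<Rightarrow>\<^sub>C complex"

lemma bcontfun_nat_iff: "(f :: nat \<Rightarrow> complex) \<in> bcontfun \<longleftrightarrow> bounded (range f)"
  by (simp add: bcontfun_def continuous_on_discrete)

text \<open>The library makes \<^typ>\<open>linf\<close> a real Banach space only; the complex vector space structure
  is given by the following scalar multiplication.\<close>

definition cscale :: "complex \<Rightarrow> linf \<Rightarrow> linf" where
  "cscale c v = Bcontfun (\<lambda>n. c * apply_bcontfun v n)"

lemma cscale_apply: "apply_bcontfun (cscale c v) n = c * apply_bcontfun v n"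
proof -
  have "cmod (c * apply_bcontfun v n) \<le> cmod c * norm v" for n
    by (simp add: norm_mult norm_bounded mult_left_mono)
  then have "(\<lambda>n. c * apply_bcontfun v n) \<in> bcontfun"
    by (auto simp: bcontfun_nat_iff bounded_iff)
  then show ?thesis
    by (simp add: cscale_def Bcontfun_inverse)
qed

definition bounded_clinear_op :: "(linf \<Rightarrow> linf) \<Rightarrow> bool" where
  "bounded_clinear_op T \<longleftrightarrow> bounded_linear T \<and> (\<forall>c v. T (cscale c v) = cscale c (T v))"

definition spectrum :: "(linf \<Rightarrow> linf) \<Rightarrow> complex set" where
  "spectrum S = {z. \<not> (\<exists>T. bounded_clinear_op T \<and>
      (\<forall>v. T (S v - cscale z v) = v) \<and> (\<forall>v. S (T v) - cscale z (T v) = v))}"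

definition digit :: "nat \<Rightarrow> nat \<Rightarrow> nat \<Rightarrow> nat" where
  "digit d j n = (n div d ^ (j - 1)) mod d"

definition zeta :: "nat \<Rightarrow> nat \<Rightarrow> nat" where
  "zeta d n = (LEAST j. 1 \<le> j \<and> digit d j n \<noteq> d - 1)"

text \<open>At most one \<open>r\<close> contributes to the last sum, which is \<open>0\<close> if there is none
  (in particular if \<open>zeta d n = 1\<close>). The natural subtraction does not truncate, since the lowest
  \<open>zeta d n - 1\<close> digits of \<open>n\<close> equal \<open>d - 1\<close>. The value \<open>p 0\<close> is never used.\<close>

definition trans_prob :: "nat \<Rightarrow> (nat \<Rightarrow> real) \<Rightarrow> nat \<Rightarrow> nat \<Rightarrow> real" where
  "trans_prob d p n m =
    (if m = n + 1 then \<Prod>j=1..zeta d n. p j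
     else if m = n then 1 - p 1
     else \<Sum>r\<in>{r. 1 \<le> r \<and> r \<le> zeta d n - 1 \<and> m = n - (\<Sum>j=1..r. (d - 1) * d ^ (j - 1))}.
            (1 - p (r + 1)) * (\<Prod>j=1..r. p j))"

text \<open>Only finitely many terms of the series are nonzero. For \<open>p j \<in> {0<..1}\<close> the resulting
  sequence is bounded, so that \<open>Bcontfun\<close> is applied within its domain; see \<open>trans_op_apply\<close>.\<close>

definition trans_op :: "nat \<Rightarrow> (nat \<Rightarrow> real) \<Rightarrow> linf \<Rightarrow> linf" where
  "trans_op d p v = Bcontfun (\<lambda>n. \<Sum>m. of_real (trans_prob d p n m) * apply_bcontfun v m)"

definition fibre_poly :: "nat \<Rightarrow> (nat \<Rightarrow> real) \<Rightarrow> nat \<Rightarrow> complex \<Rightarrow> complex" where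
  "fibre_poly d p j z = ((z - (1 - of_real (p j))) / of_real (p j)) ^ d"

primrec fibre_comp :: "nat \<Rightarrow> (nat \<Rightarrow> real) \<Rightarrow> nat \<Rightarrow> complex \<Rightarrow> complex" where
  "fibre_comp d p 0 = id"
| "fibre_comp d p (Suc j) = fibre_poly d p (Suc j) \<circ> fibre_comp d p j"

definition fibred_filled_julia :: "nat \<Rightarrow> (nat \<Rightarrow> real) \<Rightarrow> complex set" where
  "fibred_filled_julia d p = {z. limsup (\<lambda>j. ereal (cmod (fibre_comp d p j z))) < \<infinity>}"

lemma digit_sum_eq:
  assumes "2 \<le> d"
  shows "(\<Sum>j=1..r. (d - 1) * d ^ (j - 1)) = d ^ r - (1::nat)"
proof (induction r)
  case (Suc r)
  have "d ^ r \<ge> 1" using assms by simp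
  then show ?case using Suc assms
    by (simp add: algebra_simps diff_mult_distrib)
qed simp

lemma zeta_props:
  assumes "2 \<le> d"
  shows "1 \<le> zeta d n" "digit d (zeta d n) n \<noteq> d - 1"
    "1 \<le> j \<Longrightarrow> j < zeta d n \<Longrightarrow> digit d j n = d - 1"
proof -
  have "n < d ^ n" using assms by (intro power_gt_expt) auto
  then have "1 \<le> Suc n \<and> digit d (Suc n) n \<noteq> d - 1"
    using assms by (simp add: digit_def)
  from LeastI[of "\<lambda>j. 1 \<le> j \<and> digit d j n \<noteq> d - 1", OF this]
  show "1 \<le> zeta d n" "digit d (zeta d n) n \<noteq> d - 1" by (auto simp: zeta_def)
  show "1 \<le> j \<Longrightarrow> j < zeta d n \<Longrightarrow> digit d j n = d - 1"
    using not_less_Least[of j "\<lambda>j. 1 \<le> j \<and> digit d j n \<noteq> d - 1"]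
    by (auto simp: zeta_def)
qed

lemma digits_le:
  assumes "2 \<le> d" "\<And>j. 1 \<le> j \<Longrightarrow> j \<le> r \<Longrightarrow> digit d j n = d - 1"
  shows "n mod d ^ r = d ^ r - 1"
  using assms(2)
proof (induction r)
  case (Suc r)
  have "n mod d ^ Suc r = d ^ r * (n div d ^ r mod d) + n mod d ^ r"
    by (metis mod_mult2_eq mult.commute power_Suc)
  also have "n div d ^ r mod d = d - 1" using Suc.prems[of "Suc r"] by (simp add: digit_def)
  also have "n mod d ^ r = d ^ r - 1" using Suc by simp
  finally show ?case using assms(1) \<open>2 \<le> d\<close>
    by (simp add: algebra_simps diff_mult_distrib2)
qed simp

lemma reset_le:
  assumes "2 \<le> d" "r < zeta d n"
  shows "d ^ r - 1 \<le> n"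
  using digits_le[OF assms(1), of r n] zeta_props(3)[OF assms(1), of _ n] assms(2)
  by (metis le_less_trans mod_less_eq_dividend)

lemma trans_prob_reset:
  assumes "2 \<le> d" "1 \<le> r" "r \<le> zeta d n - 1"
  shows "trans_prob d p n (n - (\<Sum>j=1..r. (d - 1) * d ^ (j - 1))) =
    (1 - p (r + 1)) * (\<Prod>j=1..r. p j)"
proof -
  have pos: "d ^ k - 1 \<ge> 1" if "1 \<le> k" for k
    using one_less_power[of d k] assms(1) that by linarith
  have le: "d ^ k - 1 \<le> n" if "k \<le> zeta d n - 1" for k
    using reset_le[OF assms(1)] zeta_props(1)[OF assms(1), of n] that by simp
  have "{k. 1 \<le> k \<and> k \<le> zeta d n - 1 \<and> n - (d ^ r - 1) = n - (d ^ k - 1)} = {r}"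
  proof -
    have "k = r" if "1 \<le> k" "k \<le> zeta d n - 1" "n - (d ^ r - 1) = n - (d ^ k - 1)" for k
    proof -
      have "d ^ r - 1 = d ^ k - 1" using le[OF that(2)] le[OF assms(3)] that(3) by linarith
      then have "d ^ r = d ^ k" using pos[OF that(1)] pos[OF assms(2)] by linarith
      then show ?thesis using assms(1) by simp
    qed
    then show ?thesis using assms by auto
  qed
  moreover have "n - (d ^ r - 1) < n"
    using pos[OF assms(2)] le[OF assms(3)] by linarith
  then have "n - (d ^ r - 1) \<noteq> n + 1" "n - (d ^ r - 1) \<noteq> n" by linarith+
  ultimately show ?thesis
    unfolding trans_prob_def digit_sum_eq[OF assms(1)] by (simp only: if_False) simp
qed

lemma trans_prob_nonneg:
  assumes "\<And>j. 1 \<le> j \<Longrightarrow> 0 < p j \<and> p j \<le> 1"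
  shows "0 \<le> trans_prob d p n m"
proof -
  have "0 \<le> (\<Prod>j=1..k. p j)" for k
    using assms by (intro prod_nonneg) (simp add: less_imp_le)
  moreover have "0 \<le> 1 - p (r + 1)" for r
    using assms[of "r + 1"] by simp
  ultimately show ?thesis
    using assms[of 1] unfolding trans_prob_def
    by (simp only: split: if_split) (simp add: sum_nonneg)
qed

lemma trans_prob_eq_0: "n + 1 < m \<Longrightarrow> trans_prob d p n m = 0"
  by (auto simp: trans_prob_def intro!: sum.neutral)

lemma trans_prob_row_sum:
  assumes "2 \<le> d"
  shows "(\<Sum>m\<le>n + 1. trans_prob d p n m) = 1"
proof -
  define R where "R = {1..zeta d n - 1}"
  define g where "g r = n - (\<Sum>j=1..r. (d - 1) * d ^ (j - 1))" for r
  define t where "t r = (1 - p (r + 1)) * (\<Prod>j=1..r. p j)" for r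
  have lt: "g r < n" if "r \<in> R" for r
  proof -
    have "d ^ r - 1 \<le> n" using that zeta_props(1)[OF assms, of n]
      by (intro reset_le[OF assms]) (auto simp: R_def)
    moreover have "1 < d ^ r" using that assms by (intro one_less_power) (auto simp: R_def)
    ultimately show ?thesis unfolding g_def digit_sum_eq[OF assms] by linarith
  qed
  have tp: "trans_prob d p n m = (\<Sum>r\<in>{r\<in>R. g r = m}. t r)" if "m < n" for m
  proof -
    have "{r. 1 \<le> r \<and> r \<le> zeta d n - 1 \<and> m = n - (\<Sum>j=1..r. (d - 1) * d ^ (j - 1))}
      = {r\<in>R. g r = m}" by (auto simp: R_def g_def)
    then show ?thesis using that by (simp add: trans_prob_def t_def)
  qed
  have "(\<Sum>m<n. trans_prob d p n m) = (\<Sum>m<n. \<Sum>r\<in>{r\<in>R. g r = m}. t r)"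
    by (intro sum.cong) (auto simp: tp)
  also have "\<dots> = (\<Sum>r\<in>R. t r)"
    by (rule sum.group) (auto simp: R_def intro!: lt[unfolded R_def])
  also have "\<dots> = (\<Sum>r=1..<zeta d n. t r)"
    unfolding R_def using zeta_props(1)[OF assms, of n] by (intro sum.cong) auto
  also have "\<dots> = p 1 - (\<Prod>j=1..zeta d n. p j)"
  proof -
    have "(\<Sum>r=1..<Suc k. t r) = p 1 - (\<Prod>j=1..Suc k. p j)" for k
      by (induction k) (simp_all add: t_def algebra_simps)
    then show ?thesis using zeta_props(1)[OF assms, of n] by (cases "zeta d n") auto
  qed
  finally have "(\<Sum>m<n. trans_prob d p n m) = p 1 - (\<Prod>j=1..zeta d n. p j)" .
  moreover have "{..n + 1} = insert (n + 1) (insert n {..<n})" by auto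
  moreover have "trans_prob d p n n = 1 - p 1" "trans_prob d p n (n + 1) = (\<Prod>j=1..zeta d n. p j)"
    by (auto simp: trans_prob_def)
  ultimately show ?thesis by simp
qed

lemma trans_op_apply:
  assumes "2 \<le> d" "\<And>j. 1 \<le> j \<Longrightarrow> 0 < p j \<and> p j \<le> 1"
  shows "apply_bcontfun (trans_op d p v) n =
    (\<Sum>m. of_real (trans_prob d p n m) * apply_bcontfun v m)"
proof -
  have "cmod (\<Sum>m. of_real (trans_prob d p n m) * apply_bcontfun v m) \<le> norm v" for n
  proof -
    have "(\<Sum>m. of_real (trans_prob d p n m) * apply_bcontfun v m)
      = (\<Sum>m\<le>n + 1. of_real (trans_prob d p n m) * apply_bcontfun v m)"
      by (intro suminf_finite) (auto simp: trans_prob_eq_0)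
    also have "cmod \<dots> \<le> (\<Sum>m\<le>n + 1. trans_prob d p n m * norm v)"
      by (intro sum_norm_le)
        (auto simp: norm_mult abs_of_nonneg trans_prob_nonneg[OF assms(2)]
          intro!: mult_left_mono norm_bounded)
    also have "\<dots> = norm v"
      using trans_prob_row_sum[OF assms(1), of p n] by (metis mult_1 sum_distrib_right)
    finally show ?thesis .
  qed
  then have "(\<lambda>n. \<Sum>m. of_real (trans_prob d p n m) * apply_bcontfun v m) \<in> bcontfun"
    unfolding bcontfun_nat_iff bounded_iff by blast
  then show ?thesis by (simp add: trans_op_def Bcontfun_inverse)
qed

end

theory Submission
  imports Defs
begin

text \<open>Write \<open>S\<^sub>p = (1 - p\<^sub>1) I + p\<^sub>1 A\<close>. The operator \<open>A\<close> always increases the lowest digit by one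
  modulo \<open>d\<close>, and a carry performs one step of the chain of the shifted sequence \<open>\<sigma>p\<close>, so \<open>A\<^sup>d\<close> acts
  as \<open>S\<close> of \<open>\<sigma>p\<close> on each residue class modulo \<open>d\<close>. As \<open>A - w\<close> divides \<open>A\<^sup>d - w\<^sup>d\<close>, the point \<open>z\<close>
  lies in the resolvent set of \<open>S\<^sub>p\<close> once \<open>f\<^sub>1(z)\<close> lies in that of \<open>S\<close> of \<open>\<sigma>p\<close>; as \<open>S\<close> is a contraction,
  \<open>z\<close> is outside the spectrum as soon as some iterate leaves the unit disc. Iterates that leave the unit
  disc tend to infinity. If none of them does, then the product of the
  \<open>((f\<^sub>j\<^sub>-\<^sub>1 \<circ> \<dots> \<circ> f\<^sub>1)(z) - (1 - p\<^sub>j)) / p\<^sub>j\<close> to the powers \<open>a\<^sub>j(n)\<close> is a bounded eigenvector.\<close>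

section \<open>Bounded complex-linear operators on bounded sequences\<close>

lemma apply_linf_simps [simp]:
  "apply_bcontfun (u + v) n = apply_bcontfun u n + apply_bcontfun (v :: linf) n"
  "apply_bcontfun (u - v) n = apply_bcontfun u n - apply_bcontfun v n"
  "apply_bcontfun (0 :: linf) n = 0"
  "apply_bcontfun (a *\<^sub>R v) n = a *\<^sub>R apply_bcontfun v n"
  "apply_bcontfun (cscale c v) n = c * apply_bcontfun v n"
  by (simp_all add: cscale_apply plus_bcontfun.rep_eq minus_bcontfun.rep_eq zero_bcontfun.rep_eq
      scaleR_bcontfun.rep_eq)

lemma apply_Bcontfun_nat:
  assumes "\<And>n. cmod (f n) \<le> B"
  shows "apply_bcontfun (Bcontfun f) n = f (n :: nat)"
proof -
  have "f \<in> bcontfun" using assms by (auto simp: bcontfun_nat_iff bounded_iff)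
  then show ?thesis by (simp add: Bcontfun_inverse)
qed

lemma norm_cscale: "norm (cscale c v) = cmod c * norm v"
proof -
  have le: "norm (cscale c v) \<le> cmod c * norm v" for c v
    by (intro norm_bound) (simp add: norm_mult norm_bounded mult_left_mono)
  have "cmod c * norm v \<le> norm (cscale c v)" if "c \<noteq> 0"
  proof -
    \<comment> \<open>The reverse inequality is the first one for the scalar
      \<open>1 / c\<close>.\<close>
    have "v = cscale (1 / c) (cscale c v)"
      using that by (intro bcontfun_eqI) simp
    then have "norm v \<le> cmod (1 / c) * norm (cscale c v)" using le by metis
    then show ?thesis using that by (simp add: norm_divide field_simps)
  qed
  then show ?thesis using le[of c v] by (cases "c = 0") auto
qed

text \<open>Real homogeneity, which \<open>bounded_linear\<close> demands, is complex homogeneity at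
  real scalars.\<close>

lemma bounded_clinear_opI:
  assumes "\<And>u v. T (u + v) = T u + T v" "\<And>c v. T (cscale c v) = cscale c (T v)"
    "\<And>v. norm (T v) \<le> norm v * K"
  shows "bounded_clinear_op T"
proof -
  have "a *\<^sub>R v = cscale (of_real a) v" for a and v :: linf
    by (intro bcontfun_eqI) (simp add: scaleR_conv_of_real)
  then have "bounded_linear T"
    using assms by (intro bounded_linear_intro[where K = K]) auto
  then show ?thesis using assms(2) by (simp add: bounded_clinear_op_def)
qed

context
  fixes T :: "linf \<Rightarrow> linf"
  assumes T: "bounded_clinear_op T"
begin

interpretation bounded_linear T
  using T by (simp add: bounded_clinear_op_def)

lemma clinear_op_simps:
  "T (u + v) = T u + T v" "T (u - v) = T u - T v" "T 0 = 0" "T (cscale c v) = cscale c (T v)"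
  using T by (simp_all add: add diff zero bounded_clinear_op_def)

lemma clinear_op_bounded: "\<exists>K. \<forall>v. norm (T v) \<le> norm v * K"
  using bounded by blast

end

lemma bounded_clinear_op_ident: "bounded_clinear_op (\<lambda>v. v)"
  by (auto intro: bounded_clinear_opI[where K = 1])

lemma bounded_clinear_op_zero: "bounded_clinear_op (\<lambda>v. 0)"
  by (rule bounded_clinear_opI[where K = 0]) (auto intro: bcontfun_eqI)

lemma bounded_clinear_op_compose:
  assumes "bounded_clinear_op S" "bounded_clinear_op T"
  shows "bounded_clinear_op (\<lambda>v. S (T v))"
  using assms bounded_linear_compose unfolding bounded_clinear_op_def by auto

lemma bounded_clinear_op_add:
  assumes "bounded_clinear_op S" "bounded_clinear_op T"
  shows "bounded_clinear_op (\<lambda>v. S v + T v)"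
  using assms bounded_linear_add unfolding bounded_clinear_op_def
  by (auto intro!: bcontfun_eqI simp: algebra_simps)

lemma bounded_clinear_op_cscale:
  assumes "bounded_clinear_op T"
  shows "bounded_clinear_op (\<lambda>v. cscale c (T v))"
proof -
  have "bounded_clinear_op (cscale c)"
    by (rule bounded_clinear_opI[where K = "cmod c"])
      (auto intro!: bcontfun_eqI simp: norm_cscale algebra_simps)
  then show ?thesis using assms by (rule bounded_clinear_op_compose)
qed

lemma bounded_clinear_op_diff_cscale:
  assumes "bounded_clinear_op T"
  shows "bounded_clinear_op (\<lambda>v. T v - cscale c v)"
proof -
  have "(\<lambda>v. T v - cscale c v) = (\<lambda>v. T v + cscale (- c) v)"
    by (intro ext bcontfun_eqI) simp
  then show ?thesis
    using assms by (simp add: bounded_clinear_op_add bounded_clinear_op_cscale bounded_clinear_op_ident)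
qed

section \<open>Criteria for resolvent and spectrum\<close>

lemma not_in_spectrumI:
  assumes "bounded_clinear_op X" "\<And>v. X (S v - cscale z v) = v" "\<And>v. S (Y v) - cscale z (Y v) = v"
  shows "z \<notin> spectrum S"
proof -
  \<comment> \<open>Writing \<open>L = S - z\<close>, a left and a right inverse coincide:
    \<open>X = X L Y = Y\<close>. So boundedness and linearity of \<open>X\<close> suffice.\<close>
  have "X v = Y v" for v using assms(2)[of "Y v"] assms(3)[of v] by simp
  then show ?thesis using assms by (auto simp: spectrum_def)
qed

text \<open>The library's completeness instance for bounded continuous functions needs a metric on the
  domain, which \<^typ>\<open>nat\<close> does not carry.\<close>

lemma complete_linf: "complete (UNIV :: linf set)"
proof (rule completeI)
  fix f :: "nat \<Rightarrow> linf"
  assume "Cauchy f"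
  then have "uniformly_Cauchy_on UNIV (\<lambda>k. apply_bcontfun (f k))"
    unfolding uniformly_Cauchy_on_def Cauchy_def by (meson dist_bounded le_less_trans)
  then obtain g where "uniform_limit UNIV (\<lambda>k. apply_bcontfun (f k)) g sequentially"
    using Cauchy_uniformly_convergent uniformly_convergent_on_def by metis
  then obtain l where "f \<longlonglongrightarrow> l"
    using uniform_limit_bcontfunE sequentially_bot by metis
  then show "\<exists>l\<in>UNIV. f \<longlonglongrightarrow> l" by blast
qed

text \<open>Solving \<open>S v - z v = u\<close> means finding a fixed point of
  \<open>v \<mapsto> (S v - u) / z\<close>, a contraction with factor \<open>1 / cmod z\<close>. The
  lower bound \<open>cmod z - 1\<close> for \<open>S - z\<close> gives injectivity and a bounded
  inverse.\<close>

lemma not_in_spectrum_of_norm_less: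
  assumes S: "bounded_clinear_op S" and le: "\<And>v. norm (S v) \<le> norm v" and z: "1 < cmod z"
  shows "z \<notin> spectrum S"
proof -
  define L where "L v = S v - cscale z v" for v
  have L: "bounded_clinear_op L"
    unfolding L_def using S by (rule bounded_clinear_op_diff_cscale)
  have below: "(cmod z - 1) * norm v \<le> norm (L v)" for v
    using norm_triangle_ineq2[of "cscale z v" "S v"] le[of v]
    by (simp add: L_def norm_cscale norm_minus_commute algebra_simps)
  have "\<exists>v. L v = u" for u
  proof -
    define g where "g v = cscale (1 / z) (S v - u)" for v
    have "dist (g v) (g w) \<le> (1 / cmod z) * dist v w" for v w
    proof -
      have "g v - g w = cscale (1 / z) (S (v - w))"
        by (intro bcontfun_eqI) (simp add: g_def clinear_op_simps[OF S] algebra_simps)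
      then show ?thesis using le[of "v - w"]
        by (simp add: dist_norm norm_cscale norm_divide divide_right_mono)
    qed
    then have "\<exists>!v. v \<in> UNIV \<and> g v = v"
      using z by (intro Banach_fix[OF complete_linf, of "1 / cmod z"]) (auto simp: divide_less_eq)
    then obtain v where v: "g v = v" by blast
    have "cscale z (g v) = S v - u"
      using z by (intro bcontfun_eqI) (auto simp: g_def)
    then have "L v = u" using v by (simp add: L_def)
    then show ?thesis by blast
  qed
  then obtain Y where Y: "L (Y u) = u" for u by metis
  have inj: "v = w" if "L v = L w" for v w
    using below[of "v - w"] that z by (simp add: clinear_op_simps[OF L] mult_le_0_iff)
  have "bounded_clinear_op Y"
  proof (rule bounded_clinear_opI[where K = "1 / (cmod z - 1)"])
    show "norm (Y v) \<le> norm v * (1 / (cmod z - 1))" for v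
      using below[of "Y v"] z by (simp add: Y field_simps)
  qed (rule inj, simp add: clinear_op_simps[OF L] Y)+
  moreover have "Y (L v) = v" for v
    by (rule inj) (rule Y)
  ultimately show ?thesis
    using Y unfolding L_def by (rule not_in_spectrumI)
qed

text \<open>\<open>Q\<close> is the sum of \<open>w ^ (n - 1 - k) * A ^ k\<close> over
  \<open>k < n\<close>, built by the recursion \<open>Q' = A Q + w ^ n\<close>. Both orders of
  composition are recorded, as the inverse is later assembled from each side.\<close>

lemma clinear_op_power_diff_factor:
  assumes A: "bounded_clinear_op A"
  obtains Q where "bounded_clinear_op Q"
    "\<And>v. A (Q v) - cscale w (Q v) = (A ^^ n) v - cscale (w ^ n) v"
    "\<And>v. Q (A v - cscale w v) = (A ^^ n) v - cscale (w ^ n) v"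
proof -
  have "\<exists>Q. bounded_clinear_op Q \<and> (\<forall>v. A (Q v) - cscale w (Q v) = (A ^^ n) v - cscale (w ^ n) v)
    \<and> (\<forall>v. Q (A v - cscale w v) = (A ^^ n) v - cscale (w ^ n) v)"
  proof (induction n)
    case 0
    show ?case
      using bounded_clinear_op_zero
      by (intro exI[of _ "\<lambda>v. 0"]) (auto intro!: bcontfun_eqI simp: clinear_op_simps[OF A])
  next
    case (Suc n)
    then obtain Q where Q: "bounded_clinear_op Q"
      and 1: "\<And>v. A (Q v) - cscale w (Q v) = (A ^^ n) v - cscale (w ^ n) v"
      and 2: "\<And>v. Q (A v - cscale w v) = (A ^^ n) v - cscale (w ^ n) v" by blast
    define Q' where "Q' v = A (Q v) + cscale (w ^ n) v" for v
    have "bounded_clinear_op Q'"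
      unfolding Q'_def using A Q
      by (intro bounded_clinear_op_add bounded_clinear_op_compose[OF A] bounded_clinear_op_cscale
          bounded_clinear_op_ident)
    moreover have "A (Q' v) - cscale w (Q' v) = (A ^^ Suc n) v - cscale (w ^ Suc n) v" for v
    proof -
      have "A (Q' v) - cscale w (Q' v)
        = A (A (Q v) - cscale w (Q v)) + cscale (w ^ n) (A v) - cscale (w ^ Suc n) v"
        by (intro bcontfun_eqI) (simp add: Q'_def clinear_op_simps[OF A] algebra_simps)
      then show ?thesis by (simp add: 1 clinear_op_simps[OF A])
    qed
    moreover have "Q' (A v - cscale w v) = (A ^^ Suc n) v - cscale (w ^ Suc n) v" for v
      unfolding Q'_def 2
      by (intro bcontfun_eqI) (simp add: clinear_op_simps[OF A] algebra_simps)
    ultimately show ?case by blast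
  qed
  then show thesis using that by blast
qed

lemma eigenvalue_in_spectrum:
  assumes "S v = cscale z v" "v \<noteq> 0"
  shows "z \<in> spectrum S"
proof -
  have False if T: "bounded_clinear_op T" and "\<And>v. T (S v - cscale z v) = v" for T
    using that(2)[of v] assms by (simp add: clinear_op_simps[OF T])
  then show ?thesis by (auto simp: spectrum_def)
qed

section \<open>Carries and the recursion of the transition sums\<close>

lemma zeta_no_carry:
  assumes "n mod d \<noteq> d - 1"
  shows "zeta d n = 1"
  unfolding zeta_def using assms by (intro Least_equality) (auto simp: digit_def)

text \<open>The lowest digit is \<open>d - 1\<close> and the others are those of
  \<open>n div d\<close>, one place further down.\<close>

lemma zeta_carry:
  assumes "2 \<le> d" "n mod d = d - 1"
  shows "zeta d n = Suc (zeta d (n div d))"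
proof -
  have shift: "digit d (Suc j) n = digit d j (n div d)" if "1 \<le> j" for j
    using that by (cases j) (auto simp: digit_def div_mult2_eq)
  show ?thesis
    unfolding zeta_def[of d n]
  proof (rule Least_equality)
    show "1 \<le> Suc (zeta d (n div d)) \<and> digit d (Suc (zeta d (n div d))) n \<noteq> d - 1"
      using zeta_props(1,2)[OF assms(1), of "n div d"] by (simp add: shift)
  next
    fix j assume j: "1 \<le> j \<and> digit d j n \<noteq> d - 1"
    then obtain k where k: "j = Suc k" by (cases j) auto
    have "k \<noteq> 0"
      using j k assms by (cases k) (auto simp: digit_def)
    then have "digit d k (n div d) \<noteq> d - 1" using j shift[of k] k by auto
    then have "\<not> k < zeta d (n div d)"
      using zeta_props(3)[OF assms(1), of k "n div d"] \<open>k \<noteq> 0\<close> by auto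
    then show "Suc (zeta d (n div d)) \<le> j" using k by simp
  qed
qed

context
  fixes d :: nat
  assumes d: "2 \<le> d"
begin

text \<open>The series is reordered by the number \<open>r\<close> of digits that are reset. Staying
  at \<open>n\<close> becomes the case \<open>r = 0\<close>, with an empty product, so one formula
  covers all moves except the increment.\<close>

lemma trans_prob_sum:
  fixes v :: "nat \<Rightarrow> complex"
  shows "(\<Sum>m. of_real (trans_prob d p n m) * v m) =
    (\<Sum>r<zeta d n. of_real ((1 - p (r + 1)) * (\<Prod>j=1..r. p j)) * v (n - (d ^ r - 1)))
    + of_real (\<Prod>j=1..zeta d n. p j) * v (n + 1)"
proof -
  define R where "R = {1..zeta d n - 1}"
  define g where "g r = n - (d ^ r - 1)" for r
  define t where "t r = (1 - p (r + 1)) * (\<Prod>j=1..r. p j)" for r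
  have lt: "g r < n" if "r \<in> R" for r
  proof -
    have "d ^ r - 1 \<le> n" using that zeta_props(1)[OF d, of n]
      by (intro reset_le[OF d]) (auto simp: R_def)
    moreover have "1 < d ^ r" using that d by (intro one_less_power) (auto simp: R_def)
    ultimately show ?thesis unfolding g_def by linarith
  qed
  have tp: "trans_prob d p n m = (\<Sum>r\<in>{r\<in>R. g r = m}. t r)" if "m < n" for m
  proof -
    have "{r. 1 \<le> r \<and> r \<le> zeta d n - 1 \<and> m = n - (d ^ r - 1)} = {r\<in>R. g r = m}"
      by (auto simp: R_def g_def)
    then show ?thesis using that unfolding trans_prob_def digit_sum_eq[OF d] by (simp add: t_def)
  qed
  have "(\<Sum>m. of_real (trans_prob d p n m) * v m)
      = (\<Sum>m\<le>n + 1. of_real (trans_prob d p n m) * v m)"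
    by (intro suminf_finite) (auto simp: trans_prob_eq_0)
  also have "{..n + 1} = insert (n + 1) (insert n {..<n})" by auto
  also have "(\<Sum>m\<in>\<dots>. of_real (trans_prob d p n m) * v m) =
      of_real (\<Prod>j=1..zeta d n. p j) * v (n + 1) + of_real (t 0) * v (g 0)
      + (\<Sum>m<n. of_real (trans_prob d p n m) * v m)"
    by (simp add: trans_prob_def t_def g_def)
  also have "(\<Sum>m<n. of_real (trans_prob d p n m) * v m)
      = (\<Sum>m<n. \<Sum>r\<in>{r\<in>R. g r = m}. of_real (t r) * v (g r))"
    by (intro sum.cong) (auto simp: tp sum_distrib_right)
  \<comment> \<open>Each \<open>r\<close> in \<open>R\<close> has exactly one target
    \<open>g r\<close>, which lies below \<open>n\<close>, so the inner index sets partition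
    \<open>R\<close>.\<close>
  also have "\<dots> = (\<Sum>r\<in>R. of_real (t r) * v (g r))"
    by (rule sum.group) (auto simp: R_def intro!: lt[unfolded R_def])
  finally have "(\<Sum>m. of_real (trans_prob d p n m) * v m) =
      of_real (\<Prod>j=1..zeta d n. p j) * v (n + 1) + (\<Sum>r\<in>insert 0 R. of_real (t r) * v (g r))"
    by (simp add: R_def)
  moreover have "insert 0 R = {..<zeta d n}"
    using zeta_props(1)[OF d, of n] by (auto simp: R_def)
  ultimately show ?thesis by (simp add: t_def g_def add.commute)
qed

text \<open>One step of the chain, seen from the lowest digit: it stays with probability
  \<open>1 - p 1\<close> and otherwise increases. On a carry it becomes \<open>0\<close> and the
  number \<open>n div d\<close> of the higher digits makes a step of the shifted chain, hence the
  argument \<open>d * m\<close>.\<close>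

lemma trans_prob_sum_rec:
  fixes v :: "nat \<Rightarrow> complex"
  shows "(\<Sum>m. of_real (trans_prob d p n m) * v m) = of_real (1 - p 1) * v n + of_real (p 1) *
    (if n mod d = d - 1
     then \<Sum>m. of_real (trans_prob d (\<lambda>j. p (Suc j)) (n div d) m) * v (d * m)
     else v (n + 1))"
proof (cases "n mod d = d - 1")
  case False
  then show ?thesis by (simp add: trans_prob_sum zeta_no_carry lessThan_Suc)
next
  case True
  define m where "m = n div d"
  have n: "n + 1 = d * (m + 1)"
    using True d div_mult_mod_eq[of n d] by (simp add: m_def algebra_simps)
  \<comment> \<open>Resetting \<open>r + 1\<close> digits of \<open>n\<close> clears the lowest one
    and resets \<open>r\<close> digits of \<open>m\<close>. The identity holds for every
    \<open>r\<close>, also where the subtraction truncates.\<close>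
  have g: "n - (d ^ Suc r - 1) = d * (m - (d ^ r - 1))" for r
  proof -
    have "1 \<le> d ^ r" "1 \<le> d ^ Suc r" using d by simp_all
    then have "n - (d ^ Suc r - 1) = d * (m + 1) - d * d ^ r" using n by simp
    also have "\<dots> = d * (m + 1 - d ^ r)" by (simp add: diff_mult_distrib2)
    also have "m + 1 - d ^ r = m - (d ^ r - 1)" using \<open>1 \<le> d ^ r\<close> by simp
    finally show ?thesis .
  qed
  have P: "(\<Prod>j=1..Suc r. p j) = p 1 * (\<Prod>j=1..r. p (Suc j))" for r
    by (simp add: prod.atLeast_Suc_atMost prod.shift_bounds_cl_Suc_ivl del: prod.cl_ivl_Suc)
  show ?thesis
    using True unfolding trans_prob_sum zeta_carry[OF d True] m_def[symmetric] n P
      sum.lessThan_Suc_shift g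
    by (simp add: sum_distrib_left algebra_simps)
qed

end

section \<open>Linearity and contractivity of the transition operator\<close>

definition admissible :: "(nat \<Rightarrow> real) \<Rightarrow> bool" where
  "admissible p \<longleftrightarrow> (\<forall>j\<ge>1. 0 < p j \<and> p j \<le> 1)"

lemma admissible_shift: "admissible p \<Longrightarrow> admissible (\<lambda>j. p (Suc j))"
  by (simp add: admissible_def)

context
  fixes d :: nat
  assumes d: "2 \<le> d"
begin

lemma trans_op_rec:
  assumes "admissible p"
  shows "apply_bcontfun (trans_op d p v) n =
    of_real (1 - p 1) * apply_bcontfun v n + of_real (p 1) *
    (if n mod d = d - 1
     then \<Sum>m. of_real (trans_prob d (\<lambda>j. p (Suc j)) (n div d) m) * apply_bcontfun v (d * m)
     else apply_bcontfun v (n + 1))"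
  using assms trans_op_apply[OF d] trans_prob_sum_rec[OF d] by (simp add: admissible_def)

text \<open>The recursion exhibits the sum as a convex combination of \<open>v n\<close> and a term
  that is either a value of \<open>v\<close> or, after a carry, the same kind of sum at
  \<open>n div d < n\<close>. The induction varies \<open>p\<close> and \<open>v\<close>, since the
  latter sum belongs to the shifted sequence and to \<open>m \<mapsto> v (d * m)\<close>.\<close>

lemma norm_trans_prob_sum_le:
  assumes "admissible p" "\<And>m. cmod (v m) \<le> B"
  shows "cmod (\<Sum>m. of_real (trans_prob d p n m) * v m) \<le> B"
  using assms
proof (induction n arbitrary: p v rule: less_induct)
  case (less n)
  define u where "u = (if n mod d = d - 1
     then \<Sum>m. of_real (trans_prob d (\<lambda>j. p (Suc j)) (n div d) m) * v (d * m)
     else v (n + 1))"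
  have p: "0 < p 1" "p 1 \<le> 1" using less.prems(1) by (auto simp: admissible_def)
  have "cmod u \<le> B"
  proof (cases "n mod d = d - 1")
    case True
    then have "n \<noteq> 0" using d by (cases n) auto
    then have "n div d < n" using d by simp
    then show ?thesis
      using True less.prems by (auto simp: u_def intro!: less.IH admissible_shift)
  qed (use less.prems in \<open>simp add: u_def\<close>)
  then have "cmod (of_real (1 - p 1) * v n + of_real (p 1) * u) \<le> (1 - p 1) * B + p 1 * B"
    using p less.prems(2)[of n]
    by (intro norm_triangle_mono) (simp_all add: norm_mult mult_left_mono del: of_real_diff)
  then show ?case
    unfolding trans_prob_sum_rec[OF d, of p n v] u_def by (simp add: algebra_simps)
qed

lemma norm_trans_op_le:
  assumes "admissible p"
  shows "norm (trans_op d p v) \<le> norm v"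
proof (rule norm_bound)
  fix n
  show "cmod (apply_bcontfun (trans_op d p v) n) \<le> norm v"
    using assms trans_op_apply[OF d, of p v n]
    by (auto simp: admissible_def intro!: norm_trans_prob_sum_le norm_bounded)
qed

lemma bounded_clinear_op_trans_op:
  assumes "admissible p"
  shows "bounded_clinear_op (trans_op d p)"
proof -
  have *: "apply_bcontfun (trans_op d p v) n
      = (\<Sum>m\<le>n + 1. of_real (trans_prob d p n m) * apply_bcontfun v m)" for v n
  proof -
    have "(\<Sum>m. of_real (trans_prob d p n m) * apply_bcontfun v m)
      = (\<Sum>m\<le>n + 1. of_real (trans_prob d p n m) * apply_bcontfun v m)"
      by (intro suminf_finite) (auto simp: trans_prob_eq_0)
    then show ?thesis using assms trans_op_apply[OF d, of p v n] by (auto simp: admissible_def)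
  qed
  show ?thesis
  proof (rule bounded_clinear_opI[where K = 1])
    show "trans_op d p (u + v) = trans_op d p u + trans_op d p v" for u v
      by (intro bcontfun_eqI) (simp add: * algebra_simps sum.distrib del: sum.atMost_Suc)
    show "trans_op d p (cscale c v) = cscale c (trans_op d p v)" for c v
      by (intro bcontfun_eqI) (simp add: * algebra_simps sum_distrib_left del: sum.atMost_Suc)
  qed (use norm_trans_op_le[OF assms] in simp)
qed

section \<open>Residue classes modulo \<open>d\<close> and passage to the shifted sequence\<close>

definition residue_block :: "nat \<Rightarrow> linf \<Rightarrow> linf" where
  "residue_block i v = Bcontfun (\<lambda>m. apply_bcontfun v (i + d * m))"

lemma apply_residue_block [simp]:
  "apply_bcontfun (residue_block i v) m = apply_bcontfun v (i + d * m)"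
  unfolding residue_block_def by (rule apply_Bcontfun_nat) (rule norm_bounded)

lemma norm_residue_block_le: "norm (residue_block i v) \<le> norm v"
  by (intro norm_bound) (simp add: norm_bounded)

text \<open>Every index is \<open>i + d * m\<close> with \<open>i = n mod d\<close> and
  \<open>m = n div d\<close>. Thus the blocks identify the space with a product of \<open>d\<close>
  copies of itself, and operator identities can be checked block by block.\<close>

lemma residue_block_eqI:
  assumes "\<And>i. i < d \<Longrightarrow> residue_block i u = residue_block i v"
  shows "u = v"
proof (rule bcontfun_eqI)
  fix n
  have "apply_bcontfun (residue_block (n mod d) u) (n div d)
    = apply_bcontfun (residue_block (n mod d) v) (n div d)"
    using d by (simp only: assms mod_less_divisor)
  then show "apply_bcontfun u n = apply_bcontfun v n" by simp
qed

lemma residue_block_linear: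
  "residue_block i (u + v) = residue_block i u + residue_block i v"
  "residue_block i (u - v) = residue_block i u - residue_block i v"
  "residue_block i (cscale c v) = cscale c (residue_block i v)"
  by (auto intro: bcontfun_eqI)

text \<open>This is the operator \<open>A\<close> of the overview: the step conditioned on the
  lowest digit moving.\<close>

definition normalized_op :: "(nat \<Rightarrow> real) \<Rightarrow> linf \<Rightarrow> linf" where
  "normalized_op p v = cscale (1 / of_real (p 1)) (trans_op d p v - cscale (of_real (1 - p 1)) v)"

lemma bounded_clinear_op_normalized_op:
  "admissible p \<Longrightarrow> bounded_clinear_op (normalized_op p)"
  unfolding normalized_op_def
  by (intro bounded_clinear_op_cscale bounded_clinear_op_diff_cscale bounded_clinear_op_trans_op)

lemma normalized_op_apply:
  assumes "admissible p"
  shows "apply_bcontfun (normalized_op p v) n = (if n mod d = d - 1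
     then \<Sum>m. of_real (trans_prob d (\<lambda>j. p (Suc j)) (n div d) m) * apply_bcontfun v (d * m)
     else apply_bcontfun v (n + 1))"
proof -
  have "p 1 \<noteq> 0" using assms by (auto simp: admissible_def)
  then show ?thesis by (simp add: normalized_op_def trans_op_rec[OF assms])
qed

text \<open>Without a carry the higher digits are untouched, so the operator only moves the blocks
  by one place. The next lemma closes the cycle at the last block, where the shifted chain
  enters.\<close>

lemma residue_block_normalized_op:
  assumes "admissible p" "i < d - 1"
  shows "residue_block i (normalized_op p v) = residue_block (Suc i) v"
  using assms by (intro bcontfun_eqI) (auto simp: normalized_op_apply)

lemma residue_block_normalized_op_carry:
  assumes "admissible p"
  shows "residue_block (d - 1) (normalized_op p v) = trans_op d (\<lambda>j. p (Suc j)) (residue_block 0 v)"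
proof (rule bcontfun_eqI)
  fix m
  have "(d - 1 + d * m) mod d = d - 1" "(d - 1 + d * m) div d = m"
    using d by (simp_all del: Nat.add_diff_assoc2 Nat.add_diff_assoc Nat.diff_add_assoc2)
  then show "apply_bcontfun (residue_block (d - 1) (normalized_op p v)) m
    = apply_bcontfun (trans_op d (\<lambda>j. p (Suc j)) (residue_block 0 v)) m"
    using assms trans_op_apply[OF d, of "\<lambda>j. p (Suc j)"] admissible_shift[OF assms]
    by (simp add: normalized_op_apply admissible_def del: One_nat_def)
qed

lemma residue_block_normalized_op_funpow:
  assumes "admissible p" "i + k < d"
  shows "residue_block i ((normalized_op p ^^ k) v) = residue_block (i + k) v"
  using assms(2)
proof (induction k arbitrary: i)
  case (Suc k)
  then show ?case using assms(1) Suc.IH[of "Suc i"] by (simp add: residue_block_normalized_op)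
qed simp

text \<open>Going once round the cycle of \<open>d\<close> blocks returns to the same block and
  crosses the carry exactly once.\<close>

lemma residue_block_normalized_op_funpow_d:
  assumes "admissible p" "i < d"
  shows "residue_block i ((normalized_op p ^^ d) v) = trans_op d (\<lambda>j. p (Suc j)) (residue_block i v)"
proof -
  \<comment> \<open>From block \<open>i\<close> there are \<open>d - 1 - i\<close> moves up to block
    \<open>d - 1\<close>, one carry to block \<open>0\<close>, and \<open>i\<close> moves back to
    block \<open>i\<close>.\<close>
  have "d = (d - 1 - i) + Suc i" using assms(2) by simp
  then have "normalized_op p ^^ d = normalized_op p ^^ (d - 1 - i) \<circ> normalized_op p ^^ Suc i"
    by (metis funpow_add)
  then have "residue_block i ((normalized_op p ^^ d) v)
    = residue_block (i + (d - 1 - i)) (normalized_op p ((normalized_op p ^^ i) v))"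
    using assms by (simp add: residue_block_normalized_op_funpow del: add_diff_inverse_nat)
  also have "i + (d - 1 - i) = d - 1" using assms(2) by simp
  also have "residue_block (d - 1) (normalized_op p ((normalized_op p ^^ i) v))
    = trans_op d (\<lambda>j. p (Suc j)) (residue_block i v)"
    using assms by (simp add: residue_block_normalized_op_carry residue_block_normalized_op_funpow
        del: One_nat_def)
  finally show ?thesis .
qed

text \<open>This lifts the resolvent of the shifted operator to the whole space: \<open>R\<close>
  acts on each block separately, and since the norm is a supremum, a nonnegative bound for
  \<open>R\<close> also bounds \<open>B\<close>.\<close>

lemma blockwise_op:
  assumes R: "bounded_clinear_op R"
  obtains B where "bounded_clinear_op B"
    "\<And>i v. i < d \<Longrightarrow> residue_block i (B v) = R (residue_block i v)"
proof -
  obtain K where K: "norm (R v) \<le> norm v * K" for v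
    using clinear_op_bounded[OF R] by blast
  \<comment> \<open>The constant is made nonnegative so that it can multiply the inequality between
    the norms of a block and of \<open>v\<close>.\<close>
  have K': "norm (R v) \<le> norm v * max K 0" for v
    using K[of v] by (rule order_trans) (simp add: mult_left_mono)
  define B where
    "B v = Bcontfun (\<lambda>n. apply_bcontfun (R (residue_block (n mod d) v)) (n div d))" for v
  have le: "cmod (apply_bcontfun (R (residue_block i v)) m) \<le> norm v * max K 0" for v i m
  proof -
    have "cmod (apply_bcontfun (R (residue_block i v)) m) \<le> norm (R (residue_block i v))"
      by (rule norm_bounded)
    also have "\<dots> \<le> norm (residue_block i v) * max K 0" by (rule K')
    also have "\<dots> \<le> norm v * max K 0"
      by (intro mult_right_mono norm_residue_block_le) simp
    finally show ?thesis .
  qed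
  have B: "apply_bcontfun (B v) n = apply_bcontfun (R (residue_block (n mod d) v)) (n div d)" for v n
    unfolding B_def by (rule apply_Bcontfun_nat) (rule le)
  show thesis
  proof (rule that)
    show "bounded_clinear_op B"
      by (rule bounded_clinear_opI[where K = "max K 0"])
        (auto intro!: bcontfun_eqI norm_bound le simp: B residue_block_linear clinear_op_simps[OF R])
    show "residue_block i (B v) = R (residue_block i v)" if "i < d" for i v
      using that by (intro bcontfun_eqI) (simp add: B)
  qed
qed

text \<open>Since \<open>S - z = p 1 * (A - w)\<close> with \<open>w ^ d\<close> equal to
  \<open>fibre_poly d p 1 z\<close>, it is enough to invert \<open>A - w\<close>. This is a factor
  of \<open>A ^ d - w ^ d\<close>, which acts on each block as the shifted operator minus
  \<open>w ^ d\<close> and hence has the blockwise inverse \<open>B\<close>.\<close>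

lemma not_in_spectrum_trans_op_step:
  assumes p: "admissible p"
    and notin: "fibre_poly d p 1 z \<notin> spectrum (trans_op d (\<lambda>j. p (Suc j)))"
  shows "z \<notin> spectrum (trans_op d p)"
proof -
  define A where "A = normalized_op p"
  define w where "w = (z - (1 - of_real (p 1))) / of_real (p 1)"
  have p1: "p 1 \<noteq> 0" using p by (auto simp: admissible_def)
  have A: "bounded_clinear_op A"
    unfolding A_def using p by (rule bounded_clinear_op_normalized_op)
  have S: "trans_op d p v - cscale z v = cscale (of_real (p 1)) (A v - cscale w v)" for v
    using p1 by (intro bcontfun_eqI) (simp add: A_def normalized_op_def w_def field_simps)
  have wd: "w ^ d = fibre_poly d p 1 z" by (simp add: w_def fibre_poly_def)
  from notin obtain R where R: "bounded_clinear_op R"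
    and R1: "\<And>v. R (trans_op d (\<lambda>j. p (Suc j)) v - cscale (w ^ d) v) = v"
    and R2: "\<And>v. trans_op d (\<lambda>j. p (Suc j)) (R v) - cscale (w ^ d) (R v) = v"
    by (auto simp: spectrum_def wd)
  obtain B where B: "bounded_clinear_op B"
    and block: "\<And>i v. i < d \<Longrightarrow> residue_block i (B v) = R (residue_block i v)"
    using blockwise_op[OF R] by blast
  have B1: "B ((A ^^ d) v - cscale (w ^ d) v) = v" for v
    by (rule residue_block_eqI)
      (simp add: block residue_block_linear A_def residue_block_normalized_op_funpow_d[OF p] R1)
  have B2: "(A ^^ d) (B v) - cscale (w ^ d) (B v) = v" for v
    by (rule residue_block_eqI)
      (simp add: block residue_block_linear A_def residue_block_normalized_op_funpow_d[OF p] R2)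
  obtain Q where Q: "bounded_clinear_op Q"
    and Q1: "\<And>v. A (Q v) - cscale w (Q v) = (A ^^ d) v - cscale (w ^ d) v"
    and Q2: "\<And>v. Q (A v - cscale w v) = (A ^^ d) v - cscale (w ^ d) v"
    using clinear_op_power_diff_factor[OF A] by blast
  have inv: "cscale (1 / of_real (p 1)) (cscale (of_real (p 1)) v) = v"
    "cscale (of_real (p 1)) (cscale (1 / of_real (p 1)) v) = v" for v
    using p1 by (auto intro: bcontfun_eqI)
  show ?thesis
  \<comment> \<open>\<open>B Q\<close> serves as left inverse of \<open>A - w\<close> and
    \<open>Q B\<close> as right inverse, so \<open>B\<close> and \<open>Q\<close> need not be shown
    to commute.\<close>
  proof (rule not_in_spectrumI)
    show "bounded_clinear_op (\<lambda>v. B (Q (cscale (1 / of_real (p 1)) v)))"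
      by (intro bounded_clinear_op_compose[OF B] bounded_clinear_op_compose[OF Q]
          bounded_clinear_op_cscale bounded_clinear_op_ident)
    show "B (Q (cscale (1 / of_real (p 1)) (trans_op d p v - cscale z v))) = v" for v
      unfolding S inv Q2 B1 ..
    show "trans_op d p (Q (B (cscale (1 / of_real (p 1)) v)))
      - cscale z (Q (B (cscale (1 / of_real (p 1)) v))) = v" for v
      unfolding S Q1 B2 inv ..
  qed
qed

text \<open>The recursion of \<open>fibre_comp\<close> adds the outermost polynomial. Inductions
  along the shift must instead split off the innermost one.\<close>

lemma fibre_comp_Suc_shift:
  "fibre_comp d p (Suc j) z = fibre_comp d (\<lambda>j. p (Suc j)) j (fibre_poly d p 1 z)"
  by (induction j) (simp_all add: fibre_poly_def)

text \<open>Each induction step trades \<open>p\<close> and \<open>z\<close> for the shifted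
  sequence and the image of \<open>z\<close>. At \<open>j = 0\<close> the point itself is outside
  the unit disc, where contractivity applies.\<close>

lemma not_in_spectrum_trans_op:
  assumes "admissible p" "1 < cmod (fibre_comp d p j z)"
  shows "z \<notin> spectrum (trans_op d p)"
  using assms
proof (induction j arbitrary: p z)
  case 0
  then show ?case
    by (intro not_in_spectrum_of_norm_less bounded_clinear_op_trans_op norm_trans_op_le) auto
next
  case (Suc j)
  show ?case
  proof (rule not_in_spectrum_trans_op_step[OF Suc.prems(1)], rule Suc.IH)
    show "admissible (\<lambda>j. p (Suc j))" using Suc.prems(1) by (rule admissible_shift)
    show "1 < cmod (fibre_comp d (\<lambda>j. p (Suc j)) j (fibre_poly d p 1 z))"
      using Suc.prems(2) unfolding fibre_comp_Suc_shift .
  qed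
qed

end

section \<open>Eigenvectors as products over the digits\<close>

function eigenvector :: "nat \<Rightarrow> (nat \<Rightarrow> real) \<Rightarrow> complex \<Rightarrow> nat \<Rightarrow> complex" where
  "eigenvector d p z n = (if n = 0 \<or> d < 2 then 1 else
    ((z - (1 - of_real (p 1))) / of_real (p 1)) ^ (n mod d) *
    eigenvector d (\<lambda>j. p (Suc j)) (fibre_poly d p 1 z) (n div d))"
  by auto
termination
  \<comment> \<open>The argument \<open>n div d\<close> is smaller than \<open>n\<close> for
    \<open>n > 0\<close> and \<open>d \<ge> 2\<close>. The clause \<open>d < 2\<close> excludes the
    remaining bases, and the value \<open>1\<close> at \<open>n = 0\<close> is the empty
    product.\<close>
  by (relation "Wellfounded.measure (\<lambda>(d, p, z, n). n)") auto

declare eigenvector.simps [simp del]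

context
  fixes d :: nat
  assumes d: "2 \<le> d"
begin

lemma eigenvector_0: "eigenvector d p z 0 = 1"
  by (simp add: eigenvector.simps)

text \<open>At \<open>n = 0\<close> all factors are \<open>1\<close>, so the recursion holds there
  too.\<close>

lemma eigenvector_rec:
  "eigenvector d p z n = ((z - (1 - of_real (p 1))) / of_real (p 1)) ^ (n mod d) *
    eigenvector d (\<lambda>j. p (Suc j)) (fibre_poly d p 1 z) (n div d)"
proof (cases "n = 0")
  case True
  then show ?thesis by (simp add: eigenvector_0)
next
  case False
  then show ?thesis using d by (subst eigenvector.simps) simp
qed

text \<open>It suffices that the conditioned step multiplies the vector by \<open>w\<close>, because
  \<open>(1 - p 1) + p 1 * w = z\<close>. Without a carry the exponent of \<open>w\<close> grows by
  one. With a carry the factor \<open>w ^ (d - 1)\<close> is lost, but by induction the shifted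
  eigenvector gains \<open>w ^ d\<close>.\<close>

lemma eigenvector_eq:
  assumes "admissible p"
  shows "(\<Sum>m. of_real (trans_prob d p n m) * eigenvector d p z m) = z * eigenvector d p z n"
  using assms
proof (induction n arbitrary: p z rule: less_induct)
  case (less n)
  define w where "w = (z - (1 - of_real (p 1))) / of_real (p 1)"
  define e where "e = eigenvector d (\<lambda>j. p (Suc j)) (fibre_poly d p 1 z)"
  have "p 1 \<noteq> 0" using less.prems by (auto simp: admissible_def)
  then have z: "of_real (1 - p 1) * x + of_real (p 1) * (w * x) = z * x" for x
    by (simp add: w_def field_simps)
  have rec: "eigenvector d p z m = w ^ (m mod d) * e (m div d)" for m
    unfolding w_def e_def by (rule eigenvector_rec)
  have "(if n mod d = d - 1
     then \<Sum>m. of_real (trans_prob d (\<lambda>j. p (Suc j)) (n div d) m) * eigenvector d p z (d * m)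
     else eigenvector d p z (n + 1)) = w * eigenvector d p z n"
  proof (cases "n mod d = d - 1")
    case True
    then have "n \<noteq> 0" using d by (cases n) auto
    then have "n div d < n" using d by simp
    then have "(\<Sum>m. of_real (trans_prob d (\<lambda>j. p (Suc j)) (n div d) m) * e m)
        = fibre_poly d p 1 z * e (n div d)"
      unfolding e_def using less.prems by (intro less.IH admissible_shift)
    moreover have "fibre_poly d p 1 z = w * w ^ (d - 1)"
      using d by (simp add: fibre_poly_def w_def power_eq_if)
    ultimately show ?thesis using True d by (simp add: rec)
  next
    case False
    then have "n mod d + 1 < d" using d mod_less_divisor[of d n] by linarith
    then have "(n + 1) mod d = n mod d + 1" "(n + 1) div d = n div d"
      using d by (simp_all add: mod_Suc div_Suc)
    then show ?thesis using False by (simp add: rec)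
  qed
  then show ?case unfolding trans_prob_sum_rec[OF d, of p n] by (simp only: z)
qed

text \<open>The first iterate has modulus \<open>cmod w ^ d\<close>, so
  \<open>cmod w \<le> 1\<close>. The later iterates of \<open>z\<close> are the iterates of its
  image under the shifted sequence, which makes the induction go through.\<close>

lemma norm_eigenvector_le:
  assumes "\<And>j. cmod (fibre_comp d p j z) \<le> 1"
  shows "cmod (eigenvector d p z n) \<le> 1"
  using assms
proof (induction n arbitrary: p z rule: less_induct)
  case (less n)
  show ?case
  proof (cases "n = 0")
    case False
    define w where "w = (z - (1 - of_real (p 1))) / of_real (p 1)"
    have "cmod w ^ d \<le> 1"
      using less.prems[of 1] by (simp add: w_def fibre_poly_def norm_power[symmetric])
    then have "cmod w \<le> 1" using d
      by (metis linorder_not_le one_less_power pos2 order_less_le_trans)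
    moreover have "cmod (eigenvector d (\<lambda>j. p (Suc j)) (fibre_poly d p 1 z) (n div d)) \<le> 1"
    proof (rule less.IH)
      show "n div d < n" using False d by simp
      show "cmod (fibre_comp d (\<lambda>j. p (Suc j)) j (fibre_poly d p 1 z)) \<le> 1" for j
        using less.prems[of "Suc j"] unfolding fibre_comp_Suc_shift[OF d] .
    qed
    ultimately show ?thesis
      unfolding eigenvector_rec[of p z n] w_def[symmetric]
      by (auto simp: norm_mult norm_power intro!: mult_le_one power_le_one)
  qed (simp add: eigenvector_0)
qed

lemma in_spectrum_trans_op:
  assumes p: "admissible p" and le: "\<And>j. cmod (fibre_comp d p j z) \<le> 1"
  shows "z \<in> spectrum (trans_op d p)"
proof (rule eigenvalue_in_spectrum)
  define v where "v = Bcontfun (eigenvector d p z)"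
  have v: "apply_bcontfun v n = eigenvector d p z n" for n
    unfolding v_def by (rule apply_Bcontfun_nat) (rule norm_eigenvector_le[OF le])
  show "trans_op d p v = cscale z v"
    using p trans_op_apply[OF d, of p v]
    by (intro bcontfun_eqI) (auto simp: admissible_def v eigenvector_eq[OF p])
  show "v \<noteq> 0" using v[of 0] by (auto simp: eigenvector_0)
qed

section \<open>Escape of the iterates from the unit disc\<close>

lemma norm_fibre_poly_ge:
  assumes "0 < p j" "p j \<le> 1" "1 \<le> cmod z"
  shows "cmod z ^ d \<le> cmod (fibre_poly d p j z)"
proof -
  \<comment> \<open>The difference of the two sides is
    \<open>(1 - p j) * (cmod z - 1)\<close>.\<close>
  have "cmod z * p j \<le> cmod z - (1 - p j)"
    using mult_nonneg_nonneg[of "1 - p j" "cmod z - 1"] assms by (simp add: algebra_simps)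
  also have "\<dots> \<le> cmod (z - (1 - of_real (p j)))"
    using norm_triangle_ineq2[of z "of_real (1 - p j)"] assms
    by (simp only: norm_of_real) (simp add: abs_of_nonneg)
  finally have "cmod z \<le> cmod ((z - (1 - of_real (p j))) / of_real (p j))"
    using assms by (simp add: norm_divide field_simps)
  then show ?thesis by (simp add: fibre_poly_def norm_power power_mono)
qed

text \<open>Outside the unit disc every polynomial raises the modulus at least to its power
  \<open>d \<ge> 2\<close>, so the moduli grow at least geometrically.\<close>

lemma fibre_comp_escape:
  assumes p: "admissible p" and gt: "1 < cmod (fibre_comp d p j z)"
  shows "filterlim (\<lambda>k. cmod (fibre_comp d p k z)) at_top sequentially"
proof -
  define a where "a = cmod (fibre_comp d p j z)"
  have a: "1 < a" using gt by (simp add: a_def)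
  have ge: "a ^ Suc k \<le> cmod (fibre_comp d p (k + j) z)" for k
  proof (induction k)
    case (Suc k)
    let ?c = "cmod (fibre_comp d p (k + j) z)"
    have "1 \<le> a ^ k" using a by simp
    then have "a \<le> a ^ Suc k" using a by simp
    then have "a \<le> ?c" using Suc by simp
    \<comment> \<open>One factor \<open>?c\<close> is bounded below by \<open>a ^ Suc k\<close>, the
      other only by \<open>a\<close>. This modest growth is enough for divergence.\<close>
    then have "a ^ Suc (Suc k) \<le> ?c * ?c"
      using Suc a by (simp only: power_Suc[of a "Suc k"]) (intro mult_mono, auto)
    also have "\<dots> = ?c ^ 2" by (simp add: power2_eq_square)
    also have "\<dots> \<le> ?c ^ d" using \<open>a \<le> ?c\<close> a d by (intro power_increasing) auto
    also have "\<dots> \<le> cmod (fibre_comp d p (Suc k + j) z)"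
      using p \<open>a \<le> ?c\<close> a by (simp add: admissible_def norm_fibre_poly_ge)
    finally show ?case .
  qed (simp add: a_def)
  have "filterlim (\<lambda>k. a ^ k) at_top sequentially"
    using a by (intro filterlim_at_infinity_imp_filterlim_at_top filterlim_realpow_sequentially_gt1) auto
  then have "filterlim (\<lambda>k. cmod (fibre_comp d p (k + j) z)) at_top sequentially"
    by (rule filterlim_at_top_mono)
      (use ge a in \<open>auto intro!: always_eventually order_trans[OF _ ge] simp: mult_le_cancel_right1\<close>)
  then show ?thesis
    by (simp add: filterlim_at_top
        eventually_sequentially_seg[where k = j and P = "\<lambda>k. Z \<le> cmod (fibre_comp d p k z)" for Z])
qed

text \<open>The iterates either all stay in the closed unit disc or tend to infinity, so a finite
  limit superior already forces the bound \<open>1\<close>. The index \<open>j = 0\<close> includes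
  the point \<open>z\<close> itself.\<close>

lemma fibred_filled_julia_iff:
  assumes "admissible p"
  shows "z \<in> fibred_filled_julia d p \<longleftrightarrow> (\<forall>j. cmod (fibre_comp d p j z) \<le> 1)"
proof
  assume z: "z \<in> fibred_filled_julia d p"
  show "\<forall>j. cmod (fibre_comp d p j z) \<le> 1"
  proof (rule ccontr)
    assume "\<not> ?thesis"
    then obtain j where "1 < cmod (fibre_comp d p j z)" by (auto simp: not_le)
    then have "filterlim (\<lambda>k. cmod (fibre_comp d p k z)) at_top sequentially"
      using fibre_comp_escape[OF assms] by blast
    then have "(\<lambda>k. ereal (cmod (fibre_comp d p k z))) \<longlonglongrightarrow> \<infinity>"
      by (simp add: tendsto_PInfty_eq_at_top)
    then have "limsup (\<lambda>k. ereal (cmod (fibre_comp d p k z))) = \<infinity>"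
      by (intro lim_imp_Limsup) auto
    then show False using z by (simp add: fibred_filled_julia_def)
  qed
next
  assume "\<forall>j. cmod (fibre_comp d p j z) \<le> 1"
  then have "limsup (\<lambda>j. ereal (cmod (fibre_comp d p j z))) \<le> 1"
    by (intro Limsup_bounded) auto
  then show "z \<in> fibred_filled_julia d p"
    by (auto simp: fibred_filled_julia_def intro: le_less_trans)
qed

end

theorem theorem3p4:
  fixes d :: nat and p :: "nat \<Rightarrow> real"
  assumes "d \<ge> 2"
    and "\<And>j. j \<ge> 1 \<Longrightarrow> p j \<in> {0<..1}"
    and "infinite {j. j \<ge> 1 \<and> p j < 1}"
  shows "spectrum (trans_op d p) = fibred_filled_julia d p"
proof -
  have p: "admissible p" using assms(2) by (auto simp: admissible_def)
  show ?thesis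
    \<comment> \<open>An iterate outside the closed unit disc puts \<open>z\<close> in the resolvent
      set; if there is none, \<open>z\<close> is an eigenvalue.\<close>
    using not_in_spectrum_trans_op[OF assms(1) p] in_spectrum_trans_op[OF assms(1) p]
      fibred_filled_julia_iff[OF assms(1) p] by (auto simp: not_less[symmetric])
qed

end
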